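(* For an arbitrarily small constant $\varepsilon>0$ there exists a submodular function $f:\{0,1,\dots,C\}^n\to\mathbb{R}_+$ (for some integers $C,n\ge 1$) for which the Generalized Double Greedy algorithm (described in the context) provides only a $(\frac13+\varepsilon)$-approximation for the problem of maximizing $f$ over $\{0,1,\dots,C\}^n$, i.e. the ratio of the value $f(a^{2n})$ of its output to the maximum of $f$ is at most $\frac13+\varepsilon$. This result still holds if the components are ordered such that at any time the chosen component yields the biggest increase in $f$.
   Context: Write $[C]=\{0,1,\dots,C\}$. For $x,y\in[C]^n$, $x\vee y$ and $x\wedge y$ denote the component-wise maximum and minimum. A function $f:[C]^n\to\mathbb{R}$ is submodular if $f(x)+f(y)\ge f(x\vee y)+f(x\wedge y)$ for all $x,y\in[C]^n$. For a vector $x$, $(x|x_k=c)$ denotes the vector obtained from $x$ by setting the $k$-th entry to $c$ and leaving all other entries unchanged. Generalized Double Greedy algorithm. Set $a^0=(0,\dots,0)$, $b^0=(C,\dots,C)$, $i=1$. For $k=1,\dots,n$ do the following. Compute $\delta_{a,i}=\max_{c\in[C]} f(a^{i-1}|a^{i-1}_k=c)-f(a^{i-1})$ and $\delta_{b,i}=\max_{c\in[C]} f(b^{i-1}|b^{i-1}_k=c)-f(b^{i-1})$. If $\delta_{a,i}\ge\delta_{b,i}$: let $c'$ be the maximal $c\in[C]$ attaining the maximum in $\delta_{a,i}$; set $a^i=(a^{i-1}|a^{i-1}_k=c')$, $b^i=b^{i-1}$, and then $a^{i+1}=a^i$, $b^{i+1}=(b^i|b^i_k=c')$. Otherwise: let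 $c'$ be the minimal $c\in[C]$ attaining the maximum in $\delta_{b,i}$; set $a^i=a^{i-1}$, $b^i=(b^{i-1}|b^{i-1}_k=c')$, and then $b^{i+1}=b^i$, $a^{i+1}=(a^i|a^i_k=c')$. Then increase $i$ by $2$. After the loop, return $a^{2n}$. In the second part of the claim, the order in which the components $k$ are processed is not prescribed in advance; instead, in each step the component that results in the biggest increase in $f$ is chosen. *)

theory Defs
  imports Complex_Main "HOL-Library.FuncSet"
begin

text \<open>
  Vectors of $[C]^n$ are the functions from $\{1,\dots,n\}$ to $\{0,\dots,C\}$, extended by
  \<^const>\<open>undefined\<close> outside of $\{1,\dots,n\}$.  On this set the pointwise lattice operations
  \<^const>\<open>sup\<close> and \<^const>\<open>inf\<close> of the function type are the component-wise maximum and minimum,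
  and \<open>x(k := c)\<close> is $(x|x_k=c)$.
\<close>

definition int_cube :: "nat \<Rightarrow> nat \<Rightarrow> (nat \<Rightarrow> nat) set" where
  "int_cube C n = {1..n} \<rightarrow>\<^sub>E {0..C}"

definition submodular_on_cube :: "nat \<Rightarrow> nat \<Rightarrow> ((nat \<Rightarrow> nat) \<Rightarrow> real) \<Rightarrow> bool" where
  "submodular_on_cube C n f \<longleftrightarrow>
     (\<forall>x \<in> int_cube C n. \<forall>y \<in> int_cube C n. f x + f y \<ge> f (sup x y) + f (inf x y))"

definition delta :: "nat \<Rightarrow> ((nat \<Rightarrow> nat) \<Rightarrow> real) \<Rightarrow> (nat \<Rightarrow> nat) \<Rightarrow> nat \<Rightarrow> real" where
  "delta C f z k = (MAX c\<in>{0..C}. f (z(k := c))) - f z"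

definition maximizers :: "nat \<Rightarrow> ((nat \<Rightarrow> nat) \<Rightarrow> real) \<Rightarrow> (nat \<Rightarrow> nat) \<Rightarrow> nat \<Rightarrow> nat set" where
  "maximizers C f z k = {c \<in> {0..C}. f (z(k := c)) - f z = delta C f z k}"

text \<open>
  One pass of the loop, for component \<open>k\<close>.  The two half-steps of a pass write the same value
  $c'$ into component \<open>k\<close> of both vectors, and nothing is evaluated between them; they are merged.
\<close>

definition gdg_step ::
  "nat \<Rightarrow> ((nat \<Rightarrow> nat) \<Rightarrow> real) \<Rightarrow> nat \<Rightarrow>
     (nat \<Rightarrow> nat) \<times> (nat \<Rightarrow> nat) \<Rightarrow> (nat \<Rightarrow> nat) \<times> (nat \<Rightarrow> nat)" where
  "gdg_step C f k = (\<lambda>(a, b).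
     let c' = (if delta C f a k \<ge> delta C f b k
               then Max (maximizers C f a k)
               else Min (maximizers C f b k))
     in (a(k := c'), b(k := c')))"

definition gdg_state ::
  "nat \<Rightarrow> nat \<Rightarrow> ((nat \<Rightarrow> nat) \<Rightarrow> real) \<Rightarrow> nat list \<Rightarrow> (nat \<Rightarrow> nat) \<times> (nat \<Rightarrow> nat)" where
  "gdg_state C n f ks = fold (gdg_step C f) ks (\<lambda>k\<in>{1..n}. 0, \<lambda>k\<in>{1..n}. C)"

text \<open>The output when the components are processed in the order given by the list \<open>ks\<close>.\<close>

definition gdg_output ::
  "nat \<Rightarrow> nat \<Rightarrow> ((nat \<Rightarrow> nat) \<Rightarrow> real) \<Rightarrow> nat list \<Rightarrow> nat \<Rightarrow> nat" where
  "gdg_output C n f ks = fst (gdg_state C n f ks)"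

text \<open>
  Processing \<open>k\<close> from state \<open>(a, b)\<close> increases $f$ at \<open>a\<close> by $\delta_a$ or at \<open>b\<close> by $\delta_b$,
  whichever is larger.
\<close>

definition gain ::
  "nat \<Rightarrow> ((nat \<Rightarrow> nat) \<Rightarrow> real) \<Rightarrow> (nat \<Rightarrow> nat) \<times> (nat \<Rightarrow> nat) \<Rightarrow> nat \<Rightarrow> real" where
  "gain C f = (\<lambda>(a, b) k. max (delta C f a k) (delta C f b k))"

text \<open>
  The orders that can arise when each step picks, among the components not yet processed, one
  with the biggest gain; ties may be broken in any way.
\<close>

definition greedy_order :: "nat \<Rightarrow> nat \<Rightarrow> ((nat \<Rightarrow> nat) \<Rightarrow> real) \<Rightarrow> nat list \<Rightarrow> bool" where
  "greedy_order C n f ks \<longleftrightarrow>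
     distinct ks \<and> set ks = {1..n} \<and>
     (\<forall>i < length ks. \<forall>k \<in> {1..n} - set (take i ks).
        gain C f (gdg_state C n f (take i ks)) k
          \<le> gain C f (gdg_state C n f (take i ks)) (ks ! i))"

lemma greedy_order_exists: "\<exists>ks. greedy_order C n f ks"
proof -
  let ?g = "\<lambda>ks. gain C f (gdg_state C n f ks)"
  have "\<exists>ks. length ks = m \<and> distinct ks \<and> set ks \<subseteq> {1..n} \<and>
     (\<forall>i < length ks. \<forall>k \<in> {1..n} - set (take i ks). ?g (take i ks) k \<le> ?g (take i ks) (ks ! i))"
    if "m \<le> n" for m
    using that
  proof (induction m)
    case 0
    show ?case by (rule exI[of _ "[]"]) simp
  next
    case (Suc m)
    then obtain ks where ks: "length ks = m" "distinct ks" "set ks \<subseteq> {1..n}"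
      and greedy: "\<forall>i < length ks. \<forall>k \<in> {1..n} - set (take i ks).
            ?g (take i ks) k \<le> ?g (take i ks) (ks ! i)"
      by auto
    let ?R = "{1..n} - set ks"
    have "card (set ks) < n"
      using ks(1,2) Suc.prems by (simp add: distinct_card)
    then have "?R \<noteq> {}"
      using ks(3) by (metis Diff_eq_empty_iff card_atLeastAtMost diff_Suc_1 subset_antisym nat_less_le)
    then obtain k where k: "k \<in> ?R" and "?g ks k = Max (?g ks ` ?R)"
      using Max_in[of "?g ks ` ?R"] by fastforce
    then have best: "\<forall>j \<in> ?R. ?g ks j \<le> ?g ks k"
      by simp
    show ?case
      using ks k greedy best
      by (intro exI[of _ "ks @ [k]"]) (auto simp: nth_append less_Suc_eq)
  qed
  from this[of n] obtain ks where "length ks = n" "distinct ks" "set ks \<subseteq> {1..n}"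
    "\<forall>i < length ks. \<forall>k \<in> {1..n} - set (take i ks). ?g (take i ks) k \<le> ?g (take i ks) (ks ! i)"
    by auto
  moreover from this have "set ks = {1..n}"
    by (intro card_subset_eq) (simp_all add: distinct_card)
  ultimately show ?thesis
    unfolding greedy_order_def by blast
qed

end

theory Submission
  imports Defs
begin

text \<open>
  For $C = 1$ take a weighted directed cut function on eight vertices, with arcs
  $1 \to 2, 1 \to 3$ of weight $1 + \varepsilon$, $4 \to 1$ of weight $2$, and
  $2 \to 5, 2 \to 6, 3 \to 7, 3 \to 8$ of weight $1$.  The cut $\{2,3,4\}$ has value $6$.  Vertex
  $1$ has the largest initial gain, $2 + 2\varepsilon$, and is included.  This makes it
  marginally better, by $1 + \varepsilon$ against $1 - \varepsilon$, to exclude $2$ and $3$, and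
  these gains beat all others, so $2$ and $3$ are processed next.  Every cut that contains $1$ but
  neither $2$ nor $3$ has value $2 + 2\varepsilon$, whatever happens to the other vertices.
\<close>

text \<open>On 0/1 vectors, the truncated difference \<open>x u - x v\<close> indicates that the arc $u \to v$ is cut.\<close>

definition bad_cut :: "real \<Rightarrow> (nat \<Rightarrow> nat) \<Rightarrow> real" where
  "bad_cut e x =
     (1 + e) * (real (x 1 - x 2) + real (x 1 - x 3)) + 2 * real (x 4 - x 1)
       + real (x 2 - x 5) + real (x 2 - x 6) + real (x 3 - x 7) + real (x 3 - x 8)"

section \<open>Submodularity and values of the cut function\<close>

text \<open>The contribution of an arc is the convex function \<open>max 0\<close> applied to the
  difference of two coordinates, hence submodular.\<close>

lemma monus_submodular:
  fixes x y :: "nat \<Rightarrow> nat"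
  shows "real (sup x y u - sup x y v) + real (inf x y u - inf x y v)
           \<le> real (x u - x v) + real (y u - y v)"
proof -
  have "(max a c - max b d) + (min a c - min b d) \<le> (a - b) + (c - d)" for a b c d :: nat
    by linarith
  then have "(sup x y u - sup x y v) + (inf x y u - inf x y v) \<le> (x u - x v) + (y u - y v)"
    by (simp add: sup_max inf_min)
  then show ?thesis
    by linarith
qed

lemma bad_cut_submodular:
  assumes "e \<ge> 0"
  shows "submodular_on_cube C n (bad_cut e)"
  unfolding submodular_on_cube_def
proof (intro ballI)
  fix x y :: "nat \<Rightarrow> nat"
  note m = monus_submodular[of x y]
  have "(1 + e) * ((real (sup x y 1 - sup x y 2) + real (inf x y 1 - inf x y 2))
            + (real (sup x y 1 - sup x y 3) + real (inf x y 1 - inf x y 3)))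
      \<le> (1 + e) * ((real (x 1 - x 2) + real (y 1 - y 2)) + (real (x 1 - x 3) + real (y 1 - y 3)))"
    using assms by (intro mult_left_mono add_mono m) auto
  then show "bad_cut e x + bad_cut e y \<ge> bad_cut e (sup x y) + bad_cut e (inf x y)"
    using m[of 4 1] m[of 2 5] m[of 2 6] m[of 3 7] m[of 3 8]
    unfolding bad_cut_def distrib_left by linarith
qed

lemma bad_cut_nonneg: "e \<ge> 0 \<Longrightarrow> bad_cut e x \<ge> 0"
  by (simp add: bad_cut_def)

text \<open>All arcs out of 2 and 3 start at value 0, and \<open>x 4 \<le> 1 = x 1\<close> leaves
  the weight-2 arc uncut; only the arcs out of 1 count.\<close>

lemma bad_cut_trap: "x 1 = 1 \<Longrightarrow> x 2 = 0 \<Longrightarrow> x 3 = 0 \<Longrightarrow> x 4 \<le> 1 \<Longrightarrow> bad_cut e x = 2 + 2 * e"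
  by (simp add: bad_cut_def)

lemma finite_int_cube: "finite (int_cube C n)"
  by (simp add: int_cube_def finite_PiE)

text \<open>The maximum is the denominator of the ratio, so one good cut bounds the ratio from
  above.\<close>

lemma bad_cut_Max_ge: "(MAX x\<in>int_cube 1 8. bad_cut e x) \<ge> 6"
proof -
  \<comment> \<open>This set cuts 4 -> 1 and the four unit arcs but no arc out of 1, so its value
    does not depend on \<open>e\<close>.\<close>
  let ?S = "\<lambda>k\<in>{1..8}. if k \<in> {2, 3, 4} then 1 else 0 :: nat"
  have "bad_cut e ?S = 6"
    by (simp add: bad_cut_def)
  moreover have "?S \<in> int_cube 1 8"
    by (auto simp: int_cube_def)
  ultimately show ?thesis
    using Max_ge[of "bad_cut e ` int_cube 1 8" "bad_cut e ?S"] finite_int_cube[of 1 8] by simp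
qed

text \<open>Keeps \<open>1\<close> from becoming \<open>Suc 0\<close>, so that rules about
  \<open>delta 1\<close> and component 1 still match.\<close>

declare One_nat_def [simp del]

section \<open>Steps of the algorithm\<close>

lemma delta_1: "delta 1 f z k = max (f (z(k := 0))) (f (z(k := 1))) - f z"
proof -
  have "{0..1::nat} = {0, 1}"
    by auto
  then show ?thesis
    by (simp add: delta_def)
qed

text \<open>\<open>1 - c\<close> is the other value of the component, so one comparison
  decides.\<close>

lemma maximizers_1:
  "maximizers 1 f z k = {c \<in> {0, 1}. f (z(k := c)) \<ge> f (z(k := 1 - c))}"
proof (rule set_eqI)
  fix c :: nat
  consider "c = 0" | "c = 1" | "c > 1"
    by linarith
  then show "c \<in> maximizers 1 f z k \<longleftrightarrow> c \<in> {c \<in> {0, 1}. f (z(k := c)) \<ge> f (z(k := 1 - c))}"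
    by cases (auto simp: maximizers_def delta_1 max_def)
qed

text \<open>\<open>Max\<close> breaks ties upwards, so a weak inequality between the two values
  suffices.\<close>

lemma gdg_step_1_include:
  assumes "delta 1 f a k \<ge> delta 1 f b k" "f (a(k := 1)) \<ge> f (a(k := 0))"
  shows "gdg_step 1 f k (a, b) = (a(k := 1), b(k := 1))"
proof -
  have "Max (maximizers 1 f a k) = 1"
    using assms(2) by (intro Max_eqI) (auto simp: maximizers_1)
  then show ?thesis
    using assms(1) by (simp add: gdg_step_def)
qed

text \<open>Equal deltas favour \<open>a\<close>, hence the strict inequality; ties between the two
  values go to 0 because of \<open>Min\<close>.\<close>

lemma gdg_step_1_exclude:
  assumes "delta 1 f a k < delta 1 f b k" "f (b(k := 0)) \<ge> f (b(k := 1))"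
  shows "gdg_step 1 f k (a, b) = (a(k := 0), b(k := 0))"
proof -
  have "Min (maximizers 1 f b k) = 0"
    using assms(2) by (intro Min_eqI) (auto simp: maximizers_1)
  then show ?thesis
    using assms(1) by (simp add: gdg_step_def)
qed

lemma fst_fold_gdg_step_unchanged:
  "j \<notin> set ks \<Longrightarrow> fst (fold (gdg_step C f) ks s) j = fst s j"
  by (induction ks arbitrary: s) (auto simp: gdg_step_def Let_def split: prod.splits)

text \<open>A maximum over a finite nonempty set is attained, so \<open>Max\<close> and
  \<open>Min\<close> are taken over a nonempty subset of \<open>{0..C}\<close>.\<close>

lemma maximizers_bounds:
  "Max (maximizers C f z k) \<le> C" "Min (maximizers C f z k) \<le> C"
proof -
  have "(MAX c\<in>{0..C}. f (z(k := c))) \<in> (\<lambda>c. f (z(k := c))) ` {0..C}"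
    by (intro Max_in) auto
  then obtain c where "c \<in> {0..C}" "f (z(k := c)) = (MAX c\<in>{0..C}. f (z(k := c)))"
    by force
  then have "c \<in> maximizers C f z k"
    by (simp add: maximizers_def delta_def)
  then have "maximizers C f z k \<noteq> {}"
    by blast
  moreover have "maximizers C f z k \<subseteq> {0..C}"
    by (auto simp: maximizers_def)
  ultimately show "Max (maximizers C f z k) \<le> C" "Min (maximizers C f z k) \<le> C"
    using Max_in[of "maximizers C f z k"] Min_in[of "maximizers C f z k"] finite_subset
    by fastforce+
qed

text \<open>Supplies the bound on component 4 in \<open>bad_cut_trap\<close>, whatever is processed
  later.\<close>

lemma fst_fold_gdg_step_le:
  "fst s j \<le> C \<Longrightarrow> fst (fold (gdg_step C f) ks s) j \<le> C"
  by (induction ks arbitrary: s)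
    (auto simp: gdg_step_def Let_def maximizers_bounds split: prod.splits)

section \<open>Gains along the run\<close>

context
  fixes e :: real
  assumes e: "e > 0"
begin

abbreviation (input) "zero8 \<equiv> \<lambda>k\<in>{1..8::nat}. 0 :: nat"
abbreviation (input) "one8 \<equiv> \<lambda>k\<in>{1..8::nat}. 1 :: nat"

lemmas bad_cut_eval = delta_1 bad_cut_def distrib_right

text \<open>Including a vertex in the empty set gains its outgoing weight; excluding it from the
  full set gains its incoming weight. Vertex 1 leads strictly, by at least
  \<open>2 * e\<close>.\<close>

lemma delta_start:
  shows "delta 1 (bad_cut e) zero8 1 = 2 + 2 * e" "delta 1 (bad_cut e) one8 1 = 2"
    and "k \<in> {2..8} \<Longrightarrow> delta 1 (bad_cut e) zero8 k \<le> 2"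
    and "k \<in> {2..8} \<Longrightarrow> delta 1 (bad_cut e) one8 k \<le> 1 + e"
proof -
  show "delta 1 (bad_cut e) zero8 1 = 2 + 2 * e" "delta 1 (bad_cut e) one8 1 = 2"
    using e by (simp_all add: bad_cut_eval)
  assume "k \<in> {2..8}"
  then have k: "k = 2 \<or> k = 3 \<or> k = 4 \<or> k = 5 \<or> k = 6 \<or> k = 7 \<or> k = 8"
    by auto
  show "delta 1 (bad_cut e) zero8 k \<le> 2"
    using k e by (elim disjE; simp add: bad_cut_eval)
  show "delta 1 (bad_cut e) one8 k \<le> 1 + e"
    using k e by (elim disjE; simp add: bad_cut_eval)
qed

text \<open>Including \<open>k\<close> gains two unit arcs but loses the arc from 1, a net
  \<open>1 - e\<close>; excluding it cuts that arc. No arc joins 2 and 3, so processing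
  \<open>j\<close> does not alter the gains of \<open>k\<close>.\<close>

lemma delta_after_1:
  fixes j k :: nat
  assumes "j \<in> {2, 3}" "k \<in> {2, 3} - {j}"
  shows "delta 1 (bad_cut e) (zero8(1 := 1)) k \<le> 1"
    and "delta 1 (bad_cut e) (one8(1 := 1)) k = 1 + e"
    and "delta 1 (bad_cut e) (zero8(1 := 1, j := 0)) k \<le> 1"
    and "delta 1 (bad_cut e) (one8(1 := 1, j := 0)) k = 1 + e"
proof -
  from assms have jk: "j = 2 \<and> k = 3 \<or> j = 3 \<and> k = 2"
    by auto
  show "delta 1 (bad_cut e) (zero8(1 := 1)) k \<le> 1"
    using jk e by (elim disjE conjE; simp add: bad_cut_eval)
  show "delta 1 (bad_cut e) (one8(1 := 1)) k = 1 + e"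
    using jk e by (elim disjE conjE; simp add: bad_cut_eval)
  show "delta 1 (bad_cut e) (zero8(1 := 1, j := 0)) k \<le> 1"
    using jk e by (elim disjE conjE; simp add: bad_cut_eval)
  show "delta 1 (bad_cut e) (one8(1 := 1, j := 0)) k = 1 + e"
    using jk e by (elim disjE conjE; simp add: bad_cut_eval)
qed

text \<open>With 1 included, vertex 4 gains nothing, and each of 5 to 8 has a single incoming unit
  arc. All stay below the \<open>1 + e\<close> of 2 and 3.\<close>

lemma delta_other:
  fixes j k :: nat
  assumes "j \<in> {2, 3}" "k \<in> {4..8}"
  shows "delta 1 (bad_cut e) (zero8(1 := 1)) k \<le> 1"
    and "delta 1 (bad_cut e) (one8(1 := 1)) k \<le> 1"
    and "delta 1 (bad_cut e) (zero8(1 := 1, j := 0)) k \<le> 1"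
    and "delta 1 (bad_cut e) (one8(1 := 1, j := 0)) k \<le> 1"
proof -
  from assms have j: "j = 2 \<or> j = 3" and k: "k = 4 \<or> k = 5 \<or> k = 6 \<or> k = 7 \<or> k = 8"
    by auto
  show "delta 1 (bad_cut e) (zero8(1 := 1)) k \<le> 1"
    using k by (elim disjE; simp add: bad_cut_eval)
  show "delta 1 (bad_cut e) (one8(1 := 1)) k \<le> 1"
    using k by (elim disjE; simp add: bad_cut_eval)
  show "delta 1 (bad_cut e) (zero8(1 := 1, j := 0)) k \<le> 1"
    using j k by (elim disjE; simp add: bad_cut_eval)
  show "delta 1 (bad_cut e) (one8(1 := 1, j := 0)) k \<le> 1"
    using j k by (elim disjE; simp add: bad_cut_eval)
qed

lemma step_0: "gdg_step 1 (bad_cut e) 1 (zero8, one8) = (zero8(1 := 1), one8(1 := 1))"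
  using e by (intro gdg_step_1_include) (simp_all add: delta_start, simp add: bad_cut_eval)

lemma step_1:
  assumes "j \<in> {2, 3}"
  shows "gdg_step 1 (bad_cut e) j (zero8(1 := 1), one8(1 := 1))
     = (zero8(1 := 1, j := 0), one8(1 := 1, j := 0))"
proof (rule gdg_step_1_exclude)
  \<comment> \<open>\<open>5 - j\<close> is the other element of \<open>{2, 3}\<close>; here
    \<open>j\<close> takes the place of \<open>k\<close> in \<open>delta_after_1\<close>.\<close>
  have "5 - j \<in> {2, 3}" "j \<in> {2, 3} - {5 - j}"
    using assms by auto
  then show "delta 1 (bad_cut e) (zero8(1 := 1)) j < delta 1 (bad_cut e) (one8(1 := 1)) j"
    using delta_after_1(1,2)[of "5 - j" j] e by linarith
  show "bad_cut e (one8(1 := 1, j := 0)) \<ge> bad_cut e (one8(1 := 1, j := 1))"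
    using assms e by (elim insertE emptyE; simp add: bad_cut_eval)
qed

lemma step_2:
  assumes "j \<in> {2, 3}" "k \<in> {2, 3} - {j}"
  shows "gdg_step 1 (bad_cut e) k (zero8(1 := 1, j := 0), one8(1 := 1, j := 0))
     = (zero8(1 := 1, j := 0, k := 0), one8(1 := 1, j := 0, k := 0))"
proof (rule gdg_step_1_exclude)
  show "delta 1 (bad_cut e) (zero8(1 := 1, j := 0)) k < delta 1 (bad_cut e) (one8(1 := 1, j := 0)) k"
    using delta_after_1(3,4)[OF assms] e by linarith
  from assms have "j = 2 \<and> k = 3 \<or> j = 3 \<and> k = 2"
    by auto
  then show "bad_cut e (one8(1 := 1, j := 0, k := 0)) \<ge> bad_cut e (one8(1 := 1, j := 0, k := 1))"
    using e by (elim disjE conjE; simp add: bad_cut_eval)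
qed

section \<open>Outputs and greedy orders\<close>

text \<open>Once 1, 2 and 3 are fixed, \<open>bad_cut_trap\<close> determines the value; this serves
  the natural and the greedy orders alike.\<close>

lemma gdg_output_bad_cut:
  assumes jk: "j \<in> {2, 3}" "k \<in> {2, 3} - {j}" and rest: "{1, 2, 3} \<inter> set ks = {}"
  shows "bad_cut e (gdg_output 1 8 (bad_cut e) (1 # j # k # ks)) = 2 + 2 * e"
proof -
  define s where "s = (zero8(1 := 1, j := 0, k := 0), one8(1 := 1, j := 0, k := 0))"
  have out: "gdg_output 1 8 (bad_cut e) (1 # j # k # ks) = fst (fold (gdg_step 1 (bad_cut e)) ks s)"
    unfolding gdg_output_def gdg_state_def s_def
    by (simp only: fold_simps step_0 step_1[OF jk(1)] step_2[OF jk])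
  have "fst s 1 = 1" "fst s 2 = 0" "fst s 3 = 0" "fst s 4 \<le> 1"
    using jk by (auto simp: s_def)
  then show ?thesis
    unfolding out using rest
    by (intro bad_cut_trap) (simp_all add: fst_fold_gdg_step_unchanged fst_fold_gdg_step_le)
qed

text \<open>Each choice is compared with one available competitor whose gain strictly exceeds that
  of every wrong choice.\<close>

lemma greedy_order_bad_cut:
  assumes "greedy_order 1 8 (bad_cut e) ks"
  obtains j k ks' where "ks = 1 # j # k # ks'" "j \<in> {2, 3}" "k \<in> {2, 3} - {j}"
    "{1, 2, 3} \<inter> set ks' = {}"
proof -
  have dist: "distinct ks" and set: "set ks = {1..8}"
    and best: "\<And>i m. i < length ks \<Longrightarrow> m \<in> {1..8} - set (take i ks) \<Longrightarrow>
       gain 1 (bad_cut e) (gdg_state 1 8 (bad_cut e) (take i ks)) m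
         \<le> gain 1 (bad_cut e) (gdg_state 1 8 (bad_cut e) (take i ks)) (ks ! i)"
    using assms unfolding greedy_order_def by auto
  have len: "length ks = 8"
    using dist set distinct_card by fastforce
  then obtain i j k ks' where ks: "ks = i # j # k # ks'"
    by (auto simp: numeral_eq_Suc length_Suc_conv)
  have "gain 1 (bad_cut e) (zero8, one8) 1 \<le> gain 1 (bad_cut e) (zero8, one8) i"
    using best[of 0 1] by (simp add: ks gdg_state_def)
  then have "i \<notin> {2..8}"
    using delta_start(1,2) delta_start(3,4)[of i] e by (auto simp: gain_def)
  then have i: "i = 1"
    using set ks by fastforce
  have s1: "gdg_state 1 8 (bad_cut e) [1] = (zero8(1 := 1), one8(1 := 1))"
    unfolding gdg_state_def by (simp only: fold_simps step_0)
  \<comment> \<open>Vertices 2 and 3 tie here, so comparing with 2 excludes only 4 to 8 and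
    \<open>j\<close> may be either.\<close>
  have "gain 1 (bad_cut e) (zero8(1 := 1), one8(1 := 1)) 2
      \<le> gain 1 (bad_cut e) (zero8(1 := 1), one8(1 := 1)) j"
    using best[of 1 2] s1 by (simp add: ks i take_Cons')
  then have "j \<notin> {4..8}"
    using delta_after_1(2)[of 3 2] delta_other(1,2)[of 2 j] e by (auto simp: gain_def)
  moreover have "j \<in> {1..8} - {1}"
    using set dist ks i by auto
  ultimately have j: "j \<in> {2, 3}"
    by auto
  have s2: "gdg_state 1 8 (bad_cut e) [1, j] = (zero8(1 := 1, j := 0), one8(1 := 1, j := 0))"
    unfolding gdg_state_def by (simp only: fold_simps step_0 step_1[OF j])
  \<comment> \<open>The competitor for the third choice is the one of 2 and 3 still
    unprocessed.\<close>
  define m :: nat where "m = 5 - j"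
  have m: "m \<in> {2, 3} - {j}" "m \<in> {1..8} - {1, j}"
    using j by (auto simp: m_def)
  have "gain 1 (bad_cut e) (zero8(1 := 1, j := 0), one8(1 := 1, j := 0)) m
      \<le> gain 1 (bad_cut e) (zero8(1 := 1, j := 0), one8(1 := 1, j := 0)) k"
    using best[of 2 m] s2 m(2) by (simp add: ks i numeral_2_eq_2)
  then have "k \<notin> {4..8}"
    using delta_after_1(4)[OF j m(1)] delta_other(3,4)[OF j, of k] e by (auto simp: gain_def)
  moreover have "k \<in> {1..8} - {1, j}"
    using set dist ks i by auto
  ultimately have k: "k \<in> {2, 3} - {j}"
    by auto
  have "{1, 2, 3} \<inter> set ks' = {}"
    using dist ks i j k by auto
  then show thesis
    using that ks i j k by blast
qed

end

theorem theorem5: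
  fixes \<epsilon> :: real
  assumes "\<epsilon> > 0"
  shows "\<exists>(C :: nat) (n :: nat) (f :: (nat \<Rightarrow> nat) \<Rightarrow> real).
           C \<ge> 1 \<and> n \<ge> 1 \<and>
           submodular_on_cube C n f \<and>
           (\<forall>x \<in> int_cube C n. f x \<ge> 0) \<and>
           (MAX x\<in>int_cube C n. f x) > 0 \<and>
           f (gdg_output C n f [1..<Suc n]) / (MAX x\<in>int_cube C n. f x) \<le> 1/3 + \<epsilon> \<and>
           (\<forall>ks. greedy_order C n f ks \<longrightarrow>
              f (gdg_output C n f ks) / (MAX x\<in>int_cube C n. f x) \<le> 1/3 + \<epsilon>)"
proof -
  define M where "M = (MAX x\<in>int_cube 1 8. bad_cut \<epsilon> x)"
  have M: "M \<ge> 6"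
    unfolding M_def by (rule bad_cut_Max_ge)
  have ratio: "(2 + 2 * \<epsilon>) / M \<le> 1/3 + \<epsilon>"
  proof -
    have "(2 + 2 * \<epsilon>) / M \<le> (2 + 2 * \<epsilon>) / 6"
      using M assms by (intro divide_left_mono) auto
    \<comment> \<open>The left side is \<open>1/3 + \<epsilon>/3\<close>, so
      \<open>\<epsilon>\<close> itself can serve as the perturbation of the weights.\<close>
    also have "\<dots> \<le> 1/3 + \<epsilon>"
      using assms by (simp add: field_simps)
    finally show ?thesis .
  qed
  have "[1..<Suc 8] = 1 # 2 # 3 # [4..<9]"
    by (simp add: upt_rec)
  then have natural: "bad_cut \<epsilon> (gdg_output 1 8 (bad_cut \<epsilon>) [1..<Suc 8]) = 2 + 2 * \<epsilon>"
    using gdg_output_bad_cut[OF assms, of 2 3 "[4..<9]"] by simp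
  have greedy: "bad_cut \<epsilon> (gdg_output 1 8 (bad_cut \<epsilon>) ks) = 2 + 2 * \<epsilon>"
    if "greedy_order 1 8 (bad_cut \<epsilon>) ks" for ks
    using greedy_order_bad_cut[OF assms that] gdg_output_bad_cut[OF assms] by metis
  show ?thesis
    using assms M ratio natural greedy bad_cut_submodular bad_cut_nonneg
    by (intro exI[of _ 1] exI[of _ 8] exI[of _ "bad_cut \<epsilon>"]) (auto simp flip: M_def)
qed

end
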